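(* Let $\mathfrak k$ be a field, $n\ge2$, $\Lambda=\mathfrak kF$ the group algebra of the free group $F$ on $t_1,\dots,t_n$, and $L(\Lambda)$ its Fox algebra. Let $\gamma\in\Lambda$ satisfy $\varepsilon(\gamma)=0$. If $\gamma$ is irreducible in $\Lambda$, then $L(\Lambda)\gamma=L(\Lambda)$.
   Context: $\varepsilon\colon\Lambda\to\mathfrak k$ is the augmentation ($t_i\mapsto1$). Irreducible means: a non-unit which is not a product of two non-units. Put $x_i=t_i-1$. The Fox algebra $L(\Lambda)\supseteq\Lambda$ is the $\mathfrak k$-algebra generated over $\Lambda$ by $x_1^*,\dots,x_n^*$ subject to $x_i^*x_j=\delta_{ij}$ and $\sum_{i=1}^nx_ix_i^*=1$. *)

theory Defs
  imports "HOL-Library.Poly_Mapping" "HOL-Library.Cardinality"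
begin

text \<open>
  A family indexed by \<open>1,\<dots>,n\<close> is indexed by a finite type \<open>'n\<close>, so that \<open>n = CARD('n)\<close>.
  The type \<open>'m \<Rightarrow>\<^sub>0 'k\<close> of finitely supported functions, with the convolution product
  of \<^theory>\<open>HOL-Library.Poly_Mapping\<close>, is the monoid algebra over \<open>'k\<close> of the
  (not necessarily commutative) monoid \<open>'m\<close>, which the library requires to be written
  additively.  For this reason free groups and free monoids are written additively below.
\<close>


subsection \<open>The free group\<close>

text \<open>The letter \<open>(i, True)\<close> stands for \<open>t\<^sub>i\<close>, and \<open>(i, False)\<close> for its inverse.\<close>

inductive fg_eq :: "('n \<times> bool) list \<Rightarrow> ('n \<times> bool) list \<Rightarrow> bool" where
  fg_refl: "fg_eq u u"
| fg_sym: "fg_eq u v \<Longrightarrow> fg_eq v u"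
| fg_trans: "fg_eq u v \<Longrightarrow> fg_eq v w \<Longrightarrow> fg_eq u w"
| fg_cancel: "fg_eq (u @ (i, b) # (i, \<not> b) # v) (u @ v)"

quotient_type 'n free_group = "('n \<times> bool) list" / fg_eq
  by (intro equivpI reflpI sympI transpI) (auto intro: fg_eq.intros)

lemma fg_eq_append_left: "fg_eq u v \<Longrightarrow> fg_eq (w @ u) (w @ v)"
proof (induction rule: fg_eq.induct)
  case (fg_cancel u i b v)
  show ?case using fg_eq.fg_cancel[of "w @ u" i b v] by simp
qed (auto intro: fg_eq.intros)

lemma fg_eq_append_right: "fg_eq u v \<Longrightarrow> fg_eq (u @ w) (v @ w)"
proof (induction rule: fg_eq.induct)
  case (fg_cancel u i b v)
  show ?case using fg_eq.fg_cancel[of u i b "v @ w"] by simp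
qed (auto intro: fg_eq.intros)

lemma fg_eq_append: "fg_eq u u' \<Longrightarrow> fg_eq v v' \<Longrightarrow> fg_eq (u @ v) (u' @ v')"
  by (meson fg_eq_append_left fg_eq_append_right fg_trans)

definition fg_flip :: "('n \<times> bool) list \<Rightarrow> ('n \<times> bool) list" where
  "fg_flip u = rev (map (\<lambda>(i, b). (i, \<not> b)) u)"

lemma fg_eq_flip: "fg_eq u v \<Longrightarrow> fg_eq (fg_flip u) (fg_flip v)"
proof (induction rule: fg_eq.induct)
  case (fg_cancel u i b v)
  show ?case using fg_eq.fg_cancel[of "fg_flip v" i b "fg_flip u"] by (simp add: fg_flip_def)
qed (auto intro: fg_eq.intros)

lemma fg_eq_flip_append: "fg_eq (fg_flip u @ u) []"
proof (induction u)
  case Nil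
  show ?case by (simp add: fg_flip_def fg_refl)
next
  case (Cons a u)
  obtain i b where a: "a = (i, b)" by (cases a)
  have "fg_eq (fg_flip (a # u) @ a # u) (fg_flip u @ u)"
    using fg_cancel[of "fg_flip u" i "\<not> b" u] by (simp add: fg_flip_def a)
  then show ?case using Cons.IH by (rule fg_trans)
qed

instantiation free_group :: (type) group_add
begin

lift_definition zero_free_group :: "'a free_group" is "[]" .

lift_definition plus_free_group :: "'a free_group \<Rightarrow> 'a free_group \<Rightarrow> 'a free_group" is "(@)"
  by (rule fg_eq_append)

lift_definition uminus_free_group :: "'a free_group \<Rightarrow> 'a free_group" is fg_flip
  by (rule fg_eq_flip)

definition minus_free_group :: "'a free_group \<Rightarrow> 'a free_group \<Rightarrow> 'a free_group" where
  "minus_free_group a b = a + - b"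

instance
proof
  fix a b c :: "'a free_group"
  show "a + b + c = a + (b + c)" by transfer (simp add: fg_refl)
  show "0 + a = a" by transfer (simp add: fg_refl)
  show "a + 0 = a" by transfer (simp add: fg_refl)
  show "- a + a = 0" by transfer (rule fg_eq_flip_append)
  show "a + - b = a - b" by (simp add: minus_free_group_def)
qed

end

lift_definition fg_gen :: "'n \<Rightarrow> 'n free_group" is "\<lambda>i. [(i, True)]" .


subsection \<open>The group algebra of the free group\<close>

type_synonym ('n, 'k) free_group_algebra = "'n free_group \<Rightarrow>\<^sub>0 'k"

definition scalar :: "'k::zero \<Rightarrow> ('m::zero \<Rightarrow>\<^sub>0 'k)" where
  "scalar c = Poly_Mapping.single 0 c"

definition group_gen :: "'n \<Rightarrow> ('n, 'k::field) free_group_algebra" where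
  "group_gen i = Poly_Mapping.single (fg_gen i) 1"

definition fox_x :: "'n \<Rightarrow> ('n, 'k::field) free_group_algebra" where
  "fox_x i = group_gen i - 1"

definition augmentation :: "('n, 'k::field) free_group_algebra \<Rightarrow> 'k" where
  "augmentation a = (\<Sum>g\<in>Poly_Mapping.keys a. Poly_Mapping.lookup a g)"

text \<open>
  The library predicates \<open>is_unit\<close> and \<open>irreducible\<close> are confined to commutative (semi)rings;
  here a unit has a two-sided inverse.  Note that \<open>0 = 0 * 0\<close> is not irreducible.
\<close>

definition ring_unit :: "'a::monoid_mult \<Rightarrow> bool" where
  "ring_unit u \<longleftrightarrow> (\<exists>v. u * v = 1 \<and> v * u = 1)"

definition ring_irreducible :: "'a::monoid_mult \<Rightarrow> bool" where
  "ring_irreducible p \<longleftrightarrow>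
     \<not> ring_unit p \<and> (\<forall>a b. p = a * b \<longrightarrow> ring_unit a \<or> ring_unit b)"


subsection \<open>Free algebras and two-sided ideals\<close>

datatype 'a free_monoid = Word "'a list"

instantiation free_monoid :: (type) monoid_add
begin

definition zero_free_monoid :: "'a free_monoid" where
  "zero_free_monoid = Word []"

fun plus_free_monoid :: "'a free_monoid \<Rightarrow> 'a free_monoid \<Rightarrow> 'a free_monoid" where
  "plus_free_monoid (Word u) (Word v) = Word (u @ v)"

instance
proof
  fix a b c :: "'a free_monoid"
  show "a + b + c = a + (b + c)" by (cases a; cases b; cases c) simp
  show "0 + a = a" by (cases a) (simp add: zero_free_monoid_def)
  show "a + 0 = a" by (cases a) (simp add: zero_free_monoid_def)
qed

end

definition free_gen :: "'a \<Rightarrow> ('a free_monoid \<Rightarrow>\<^sub>0 'k::field)" where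
  "free_gen a = Poly_Mapping.single (Word [a]) 1"

inductive_set two_sided_ideal :: "'r::ring set \<Rightarrow> 'r set" for S where
  ideal_zero: "0 \<in> two_sided_ideal S"
| ideal_gen: "s \<in> S \<Longrightarrow> s \<in> two_sided_ideal S"
| ideal_minus: "a \<in> two_sided_ideal S \<Longrightarrow> b \<in> two_sided_ideal S \<Longrightarrow> a - b \<in> two_sided_ideal S"
| ideal_left: "a \<in> two_sided_ideal S \<Longrightarrow> r * a \<in> two_sided_ideal S"
| ideal_right: "a \<in> two_sided_ideal S \<Longrightarrow> a * r \<in> two_sided_ideal S"

lemma ideal_uminus: "a \<in> two_sided_ideal S \<Longrightarrow> - a \<in> two_sided_ideal S"
  using ideal_minus[OF ideal_zero, of a] by simp

lemma ideal_add: "a \<in> two_sided_ideal S \<Longrightarrow> b \<in> two_sided_ideal S \<Longrightarrow> a + b \<in> two_sided_ideal S"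
  using ideal_minus[OF _ ideal_uminus, of a S b] by simp


subsection \<open>The Fox algebra\<close>

text \<open>
  The Fox algebra is presented over \<open>'k\<close> with one generator \<open>Coef a\<close> for each element \<open>a\<close> of
  the group algebra and one generator \<open>Star i\<close>, standing for \<open>x\<^sub>i\<^sup>*\<close>, for each \<open>i\<close>.  The first three
  families of relations make \<open>Coef\<close> a homomorphism of unital \<open>'k\<close>-algebras; its
  \<open>'k\<close>-linearity follows from them, since \<open>scalar c * a\<close> is the multiple of \<open>a\<close> by \<open>c\<close>.
\<close>

datatype ('a, 'n) fox_generator = Coef 'a | Star 'n

type_synonym ('n, 'k) fox_free =
  "(('n, 'k) free_group_algebra, 'n) fox_generator free_monoid \<Rightarrow>\<^sub>0 'k"

inductive_set fox_relations :: "('n::finite, 'k::field) fox_free set" where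
  "free_gen (Coef (a + b)) - (free_gen (Coef a) + free_gen (Coef b)) \<in> fox_relations"
| "free_gen (Coef (a * b)) - free_gen (Coef a) * free_gen (Coef b) \<in> fox_relations"
| "free_gen (Coef (scalar c)) - scalar c \<in> fox_relations"
| "free_gen (Star i) * free_gen (Coef (fox_x j)) - (if i = j then 1 else 0) \<in> fox_relations"
| "(\<Sum>i\<in>UNIV. free_gen (Coef (fox_x i)) * free_gen (Star i)) - 1 \<in> fox_relations"

definition fox_eq :: "('n::finite, 'k::field) fox_free \<Rightarrow> ('n, 'k) fox_free \<Rightarrow> bool" where
  "fox_eq a b \<longleftrightarrow> a - b \<in> two_sided_ideal fox_relations"

lemma fox_eq_refl: "fox_eq a a"
  by (simp add: fox_eq_def ideal_zero)

lemma fox_eq_add: "fox_eq a a' \<Longrightarrow> fox_eq b b' \<Longrightarrow> fox_eq (a + b) (a' + b')"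
  unfolding fox_eq_def by (drule (1) ideal_add) (simp add: algebra_simps)

lemma fox_eq_diff: "fox_eq a a' \<Longrightarrow> fox_eq b b' \<Longrightarrow> fox_eq (a - b) (a' - b')"
  unfolding fox_eq_def by (drule (1) ideal_minus) (simp add: algebra_simps)

lemma fox_eq_uminus: "fox_eq a a' \<Longrightarrow> fox_eq (- a) (- a')"
  using fox_eq_diff[OF fox_eq_refl[of 0]] by fastforce

lemma fox_eq_mult:
  assumes "fox_eq a a'" "fox_eq b b'"
  shows "fox_eq (a * b) (a' * b')"
proof -
  have "(a - a') * b + a' * (b - b') \<in> two_sided_ideal fox_relations"
    using assms unfolding fox_eq_def by (intro ideal_add ideal_left ideal_right)
  then show ?thesis by (simp add: fox_eq_def algebra_simps)
qed

quotient_type (overloaded) ('n, 'k) fox_algebra = "('n::finite, 'k::field) fox_free" / fox_eq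
proof (intro equivpI reflpI sympI transpI)
  fix a b c :: "('n, 'k) fox_free"
  show "fox_eq a a" by (rule fox_eq_refl)
  show "fox_eq b a" if "fox_eq a b"
    using that ideal_uminus[of "a - b"] by (simp add: fox_eq_def)
  show "fox_eq a c" if "fox_eq a b" "fox_eq b c"
    using that ideal_add[of "a - b" _ "b - c"] by (simp add: fox_eq_def)
qed

instantiation fox_algebra :: (finite, field) "{ring, monoid_mult}"
begin

lift_definition zero_fox_algebra :: "('a, 'b) fox_algebra" is 0 .

lift_definition one_fox_algebra :: "('a, 'b) fox_algebra" is 1 .

lift_definition plus_fox_algebra ::
  "('a, 'b) fox_algebra \<Rightarrow> ('a, 'b) fox_algebra \<Rightarrow> ('a, 'b) fox_algebra" is "(+)"
  by (rule fox_eq_add)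

lift_definition minus_fox_algebra ::
  "('a, 'b) fox_algebra \<Rightarrow> ('a, 'b) fox_algebra \<Rightarrow> ('a, 'b) fox_algebra" is "(-)"
  by (rule fox_eq_diff)

lift_definition uminus_fox_algebra :: "('a, 'b) fox_algebra \<Rightarrow> ('a, 'b) fox_algebra" is uminus
  by (rule fox_eq_uminus)

lift_definition times_fox_algebra ::
  "('a, 'b) fox_algebra \<Rightarrow> ('a, 'b) fox_algebra \<Rightarrow> ('a, 'b) fox_algebra" is "(*)"
  by (rule fox_eq_mult)

instance
proof
  fix a b c :: "('a, 'b) fox_algebra"
  show "a + b + c = a + (b + c)" by transfer (simp add: fox_eq_refl add.assoc)
  show "a + b = b + a" by transfer (simp add: fox_eq_refl add.commute)
  show "0 + a = a" by transfer (simp add: fox_eq_refl)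
  show "- a + a = 0" by transfer (simp add: fox_eq_refl)
  show "a - b = a + - b" by transfer (simp add: fox_eq_refl)
  show "a * b * c = a * (b * c)" by transfer (simp add: fox_eq_refl mult.assoc)
  show "(a + b) * c = a * c + b * c" by transfer (simp add: fox_eq_refl distrib_right)
  show "a * (b + c) = a * b + a * c" by transfer (simp add: fox_eq_refl distrib_left)
  show "1 * a = a" by transfer (simp add: fox_eq_refl)
  show "a * 1 = a" by transfer (simp add: fox_eq_refl)
qed

end

text \<open>The canonical map from the group algebra to its Fox algebra.\<close>

definition fox_of :: "('n::finite, 'k::field) free_group_algebra \<Rightarrow> ('n, 'k) fox_algebra" where
  "fox_of a = abs_fox_algebra (free_gen (Coef a))"

definition principal_left_ideal :: "'r::times \<Rightarrow> 'r set" where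
  "principal_left_ideal g = {a * g | a. True}"

end

theory Submission
  imports Defs
begin

text \<open>
  Let \<open>N\<close> be the left ideal of those \<open>a \<in> \<Lambda>\<close> with \<open>a \<in> L(\<Lambda>)\<gamma>\<close>.  Multiplying by the \<open>x\<^sub>i\<^sup>*\<close> shows that
  \<open>\<Sum>\<^sub>i x\<^sub>i a\<^sub>i \<in> N\<close> implies \<open>a\<^sub>i \<in> N\<close>, that is, \<open>(m\<^sub>i) \<mapsto> \<Sum>\<^sub>i x\<^sub>i m\<^sub>i\<close> is an injection \<open>M\<^sup>n \<rightarrow> M\<close> for
  \<open>M = \<Lambda>/N\<close>.  Suppose \<open>1 \<notin> N\<close>.  As in Lewin's Schreier technique, Zorn's lemma yields a connected
  subset \<open>B \<ni> 1\<close> of the Cayley graph of \<open>F\<close> that maps to a basis of \<open>M\<close>.  The elements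
  \<open>x\<^sub>i g = t\<^sub>i g - g\<close> for the edges inside \<open>B\<close> already span a subspace of codimension at most one
  in \<open>M\<close>, so by injectivity at most one edge \<open>(i, g)\<close> leaves \<open>B\<close>.  Rewriting with this edge shows
  that \<open>N = \<Lambda>\<delta>\<close>, where \<open>\<delta>\<close> is \<open>t\<^sub>i g\<close> minus its expansion in \<open>B\<close>.  Since \<open>N \<noteq> 0\<close>, the edge exists, and
  then \<open>1\<close> lies in \<open>\<Sum>\<^sub>i x\<^sub>i \<Lambda> + N\<close>, so \<open>N\<close> is not contained in the augmentation ideal.  Now
  \<open>\<gamma> = a \<delta>\<close> with \<open>\<delta>\<close> not a unit, so \<open>a\<close> is a unit and \<open>N = \<Lambda>\<gamma>\<close> has augmentation zero, a contradiction.
\<close>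

subsection \<open>Group algebras\<close>

lemma poly_mapping_span_induct [case_names zero add single]:
  fixes q :: "'m \<Rightarrow>\<^sub>0 'k::comm_monoid_add"
  assumes "P 0" "\<And>a b. P a \<Longrightarrow> P b \<Longrightarrow> P (a + b)"
    and "\<And>g c. g \<in> Poly_Mapping.keys q \<Longrightarrow> P (Poly_Mapping.single g c)"
  shows "P q"
proof -
  have eq: "q = (\<Sum>g\<in>Poly_Mapping.keys q. Poly_Mapping.single g (Poly_Mapping.lookup q g))"
    by (rule poly_mapping_eqI) (auto simp: lookup_sum lookup_single when_def in_keys_iff)
  have "P (\<Sum>g\<in>A. Poly_Mapping.single g (Poly_Mapping.lookup q g))"
    if "A \<subseteq> Poly_Mapping.keys q" for A
    using finite_subset[OF that finite_keys] that
    by (induction A rule: finite_induct) (auto intro: assms)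
  then show ?thesis
    using eq by (metis order_refl)
qed

section \<open>Scalars in a monoid algebra\<close>

lemma scalar_mult_single: "scalar c * Poly_Mapping.single g d = Poly_Mapping.single g (c * d)"
  by (simp add: scalar_def mult_single)

lemma scalar_add: "scalar (c + d) = scalar c + scalar d"
  by (simp add: scalar_def single_add)

lemma scalar_mult: "scalar c * scalar d = scalar (c * d)"
  by (simp add: scalar_def mult_single)

lemma scalar_0 [simp]: "scalar 0 = 0"
  by (simp add: scalar_def)

lemma scalar_1 [simp]: "scalar 1 = 1"
  by (simp add: scalar_def)

lemma scalar_central:
  fixes a :: "'m::monoid_add \<Rightarrow>\<^sub>0 'k::comm_semiring_1"
  shows "a * scalar c = scalar c * a"
  by (induction a rule: poly_mapping_span_induct)
    (simp_all add: distrib_left distrib_right scalar_def mult_single mult.commute)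

lemma scalar_left_commute:
  fixes a :: "'m::monoid_add \<Rightarrow>\<^sub>0 'k::comm_semiring_1"
  shows "a * (scalar c * b) = scalar c * (a * b)"
  by (metis mult.assoc scalar_central)

lemma lookup_scalar_mult:
  fixes a :: "'m::monoid_add \<Rightarrow>\<^sub>0 'k::comm_semiring_1"
  shows "Poly_Mapping.lookup (scalar c * a) g = c * Poly_Mapping.lookup a g"
  by (induction a rule: poly_mapping_span_induct)
    (simp_all add: distrib_left lookup_add scalar_mult_single lookup_single when_def)

lemma keys_scalar_mult:
  fixes a :: "'m::monoid_add \<Rightarrow>\<^sub>0 'k::comm_semiring_1"
  shows "Poly_Mapping.keys (scalar c * a) \<subseteq> Poly_Mapping.keys a"
  by (auto simp: in_keys_iff lookup_scalar_mult)

section \<open>The augmentation homomorphism\<close>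

lemma augmentation_superset:
  assumes "finite A" "Poly_Mapping.keys a \<subseteq> A"
  shows "augmentation a = (\<Sum>g\<in>A. Poly_Mapping.lookup a g)"
  unfolding augmentation_def
  using assms by (intro sum.mono_neutral_left) (auto simp: in_keys_iff)

lemma augmentation_0 [simp]: "augmentation 0 = 0"
  by (simp add: augmentation_def)

lemma augmentation_single [simp]: "augmentation (Poly_Mapping.single g c) = c"
  by (simp add: augmentation_def)

lemma augmentation_add: "augmentation (a + b) = augmentation a + augmentation b"
proof -
  let ?A = "Poly_Mapping.keys a \<union> Poly_Mapping.keys b"
  have *: "augmentation q = (\<Sum>g\<in>?A. Poly_Mapping.lookup q g)"
    if "Poly_Mapping.keys q \<subseteq> ?A" for q
    using that by (intro augmentation_superset) auto
  show ?thesis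
    using *[OF keys_add] *[of a] *[of b] by (simp add: lookup_add sum.distrib)
qed

lemma augmentation_diff: "augmentation (a - b) = augmentation a - augmentation b"
  by (metis add_diff_cancel augmentation_add diff_add_cancel)

lemma augmentation_sum: "augmentation (\<Sum>i\<in>A. f i) = (\<Sum>i\<in>A. augmentation (f i))"
  by (induction A rule: infinite_finite_induct) (simp_all add: augmentation_add)

lemma augmentation_mult: "augmentation (a * b) = augmentation a * augmentation b"
proof (induction a rule: poly_mapping_span_induct)
  case (single g c)
  show ?case
    by (induction b rule: poly_mapping_span_induct)
      (simp_all add: distrib_left augmentation_add mult_single)
qed (simp_all add: distrib_right augmentation_add)

lemma augmentation_scalar [simp]: "augmentation (scalar c) = c"
  by (simp add: scalar_def)

lemma augmentation_fox_x [simp]: "augmentation (fox_x i) = 0"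
  using augmentation_scalar[of 1]
  by (simp add: fox_x_def group_gen_def augmentation_diff)

text \<open>Letters are prepended on the left, to match sets closed under left multiplication by the
  generators and their inverses.\<close>

lemma free_group_induct [case_names zero gen gen_inv]:
  assumes "P 0" "\<And>i g. P g \<Longrightarrow> P (fg_gen i + g)" "\<And>i g. P g \<Longrightarrow> P (- fg_gen i + g)"
  shows "P g"
proof -
  have "P (abs_free_group w)" for w
  proof (induction w)
    case Nil
    then show ?case using assms(1) by (simp add: zero_free_group_def)
  next
    case (Cons a w)
    obtain i b where a: "a = (i, b)" by (cases a)
    have "abs_free_group (a # w) = (if b then fg_gen i else - fg_gen i) + abs_free_group w"
      by (simp add: a fg_gen_def plus_free_group.abs_eq uminus_free_group.abs_eq fg_flip_def)
    then show ?case
      using Cons assms by simp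
  qed
  then show ?thesis
    using Quotient_rep_abs[OF Quotient_free_group] by (metis Quotient_abs_rep Quotient_free_group)
qed

lemma fox_x_mult_single:
  "fox_x i * Poly_Mapping.single g c
    = Poly_Mapping.single (fg_gen i + g) c - Poly_Mapping.single g c"
  by (simp add: fox_x_def group_gen_def left_diff_distrib mult_single)

section \<open>Edge spans and connected subsets of the Cayley graph\<close>

text \<open>Spanned by the \<open>x\<^sub>i g\<close> for the edges \<open>g \<rightarrow> t\<^sub>i g\<close> of the Cayley graph with both ends in \<open>B\<close>.\<close>

definition edge_span ::
    "'n free_group set \<Rightarrow> ('n::finite, 'k::field) free_group_algebra set" where
  "edge_span B = {\<Sum>i\<in>UNIV. fox_x i * p i | p.
     \<forall>i. Poly_Mapping.keys (p i) \<subseteq> {g \<in> B. fg_gen i + g \<in> B}}"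

lemma edge_spanI:
  "(\<And>i. Poly_Mapping.keys (p i) \<subseteq> {g \<in> B. fg_gen i + g \<in> B}) \<Longrightarrow>
    (\<Sum>i\<in>UNIV. fox_x i * p i) \<in> edge_span B"
  by (auto simp: edge_span_def)

lemma edge_spanE:
  assumes "w \<in> edge_span B"
  obtains p where "w = (\<Sum>i\<in>UNIV. fox_x i * p i)"
    and "\<And>i. Poly_Mapping.keys (p i) \<subseteq> {g \<in> B. fg_gen i + g \<in> B}"
  using assms by (auto simp: edge_span_def)

lemma edge_span_mono: "B \<subseteq> C \<Longrightarrow> edge_span B \<subseteq> edge_span C"
  unfolding edge_span_def by blast

lemma edge_span_0: "0 \<in> edge_span B"
  using edge_spanI[of "\<lambda>_. 0" B] by simp

lemma edge_span_add:
  assumes "v \<in> edge_span B" "w \<in> edge_span B"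
  shows "v + w \<in> edge_span B"
proof -
  obtain p where p: "v = (\<Sum>i\<in>UNIV. fox_x i * p i)"
      "\<And>i. Poly_Mapping.keys (p i) \<subseteq> {g \<in> B. fg_gen i + g \<in> B}"
    using assms(1) by (rule edge_spanE) blast
  obtain q where q: "w = (\<Sum>i\<in>UNIV. fox_x i * q i)"
      "\<And>i. Poly_Mapping.keys (q i) \<subseteq> {g \<in> B. fg_gen i + g \<in> B}"
    using assms(2) by (rule edge_spanE) blast
  have "(\<Sum>i\<in>UNIV. fox_x i * (p i + q i)) \<in> edge_span B"
    using p(2) q(2) by (intro edge_spanI order_trans[OF keys_add]) auto
  then show ?thesis
    by (simp add: p(1) q(1) distrib_left sum.distrib)
qed

lemma edge_span_scalar:
  assumes "w \<in> edge_span B"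
  shows "scalar c * w \<in> edge_span B"
proof -
  obtain p where p: "w = (\<Sum>i\<in>UNIV. fox_x i * p i)"
      "\<And>i. Poly_Mapping.keys (p i) \<subseteq> {g \<in> B. fg_gen i + g \<in> B}"
    using assms(1) by (rule edge_spanE) blast
  have "(\<Sum>i\<in>UNIV. fox_x i * (scalar c * p i)) \<in> edge_span B"
    using p(2) by (intro edge_spanI order_trans[OF keys_scalar_mult]) auto
  then show ?thesis
    by (simp add: p(1) sum_distrib_left scalar_left_commute)
qed

lemma edge_span_uminus: "w \<in> edge_span B \<Longrightarrow> - w \<in> edge_span B"
  using edge_span_scalar[of w B "- 1"] by (simp add: scalar_def single_uminus)

lemma edge_span_diff: "v \<in> edge_span B \<Longrightarrow> w \<in> edge_span B \<Longrightarrow> v - w \<in> edge_span B"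
  using edge_span_add[OF _ edge_span_uminus, of v B w] by simp

lemma sum_fox_x_single:
  fixes a :: "('n::finite, 'k::field) free_group_algebra"
  shows "(\<Sum>j\<in>UNIV. fox_x j * (if j = i then a else 0)) = fox_x i * a"
proof -
  have "(\<Sum>j\<in>UNIV. fox_x j * (if j = i then a else 0)) = (\<Sum>j\<in>UNIV. if j = i then fox_x j * a else 0)"
    by (intro sum.cong) auto
  then show ?thesis by simp
qed

lemma edge_span_edge:
  assumes "g \<in> B" "fg_gen i + g \<in> B"
  shows "Poly_Mapping.single (fg_gen i + g) 1 - Poly_Mapping.single g 1 \<in> edge_span B"
proof -
  have "(\<Sum>j\<in>UNIV. fox_x j * (if j = i then Poly_Mapping.single g 1 else 0)) \<in> edge_span B"
    using assms by (intro edge_spanI) auto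
  then show ?thesis
    by (simp only: sum_fox_x_single fox_x_mult_single)
qed

text \<open>A set containing \<open>0\<close> is connected in the Cayley graph iff each \<open>g - 1\<close> is a boundary of its edges.\<close>

definition connected_subset :: "'k::field itself \<Rightarrow> 'n::finite free_group set \<Rightarrow> bool" where
  "connected_subset _ B \<longleftrightarrow> 0 \<in> B \<and>
     (\<forall>g\<in>B. Poly_Mapping.single g (1::'k) - 1 \<in> edge_span B)"

text \<open>The new edge joins \<open>h\<close> to \<open>g\<close>, and connectedness of
  \<open>B\<close> joins \<open>g\<close> to the identity. The edge may point either way, which
  costs only a sign.\<close>

lemma connected_subset_insert:
  assumes "connected_subset TYPE('k::field) B" "g \<in> B"
    and "h = fg_gen i + g \<or> g = fg_gen i + h"
  shows "connected_subset TYPE('k) (insert h B)"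
proof -
  let ?e = "\<lambda>g. Poly_Mapping.single g (1::'k)"
  have old: "?e b - 1 \<in> edge_span (insert h B)" if "b \<in> B" for b
    using assms(1) that edge_span_mono[of B "insert h B"] by (auto simp: connected_subset_def)
  have "?e h - ?e g \<in> edge_span (insert h B)"
    using assms(3)
  proof
    assume "h = fg_gen i + g"
    then show ?thesis using edge_span_edge[of g "insert h B" i] assms(2) by auto
  next
    assume "g = fg_gen i + h"
    then have "?e g - ?e h \<in> edge_span (insert h B)"
      using edge_span_edge[of h "insert h B" i] assms(2) by auto
    then show ?thesis using edge_span_uminus by fastforce
  qed
  from edge_span_add[OF this old[OF assms(2)]] have "?e h - 1 \<in> edge_span (insert h B)"
    by simp
  then show ?thesis
    using old assms(1) by (auto simp: connected_subset_def)
qed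

lemma connected_subset_Union:
  assumes "C \<noteq> {}" "\<And>B. B \<in> C \<Longrightarrow> connected_subset TYPE('k::field) B"
  shows "connected_subset TYPE('k) (\<Union>C)"
proof -
  have "Poly_Mapping.single g (1::'k) - 1 \<in> edge_span (\<Union>C)" if "B \<in> C" "g \<in> B" for B g
    using assms(2)[OF that(1)] that edge_span_mono[of B "\<Union>C"]
    by (auto simp: connected_subset_def)
  then show ?thesis
    using assms by (auto simp: connected_subset_def)
qed

text \<open>Each monomial is congruent to its coefficient modulo the edge span. Since boundaries
  have augmentation 0, the scalar is the augmentation of \<open>q\<close>.\<close>

lemma connected_subset_diff_scalar:
  fixes q :: "('n::finite, 'k::field) free_group_algebra"
  assumes "connected_subset TYPE('k) B" "Poly_Mapping.keys q \<subseteq> B"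
  shows "\<exists>c. q - scalar c \<in> edge_span B"
proof (induction q rule: poly_mapping_span_induct)
  case zero
  show ?case using edge_span_0 by (intro exI[of _ 0]) simp
next
  case (add a b)
  then obtain c d where "a - scalar c \<in> edge_span B" "b - scalar d \<in> edge_span B" by blast
  from edge_span_add[OF this] show ?case
    by (intro exI[of _ "c + d"]) (simp add: scalar_add algebra_simps)
next
  case (single g c)
  then have "Poly_Mapping.single g (1::'k) - 1 \<in> edge_span B"
    using assms by (auto simp: connected_subset_def)
  from edge_span_scalar[OF this, of c] show ?case
    by (intro exI[of _ c]) (simp add: right_diff_distrib scalar_mult_single)
qed


subsection \<open>Left ideals closed under Fox derivatives\<close>

text \<open>Condition \<open>fox_closed\<close> abstracts what left multiplication by the
  \<open>x\<^sub>i\<^sup>*\<close> provides, so that the argument runs entirely inside the group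
  algebra.\<close>

locale fox_closed_ideal =
  fixes N :: "('n::finite, 'k::field) free_group_algebra set"
  assumes ideal_0: "0 \<in> N"
    and ideal_plus: "a \<in> N \<Longrightarrow> b \<in> N \<Longrightarrow> a + b \<in> N"
    and ideal_mult: "b \<in> N \<Longrightarrow> a * b \<in> N"
    and fox_closed: "(\<Sum>i\<in>UNIV. fox_x i * p i) \<in> N \<Longrightarrow> p i \<in> N"
    and proper: "1 \<notin> N"
begin

lemma ideal_neg: "a \<in> N \<Longrightarrow> - a \<in> N"
  using ideal_mult[of a "- 1"] by simp

lemma ideal_diff: "a \<in> N \<Longrightarrow> b \<in> N \<Longrightarrow> a - b \<in> N"
  using ideal_plus[OF _ ideal_neg, of a b] by simp

text \<open>The condition on \<open>N\<close> is linear independence of the image of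
  \<open>B\<close> in \<open>\<Lambda>/N\<close>, phrased without forming the quotient.\<close>

definition schreier :: "'n free_group set \<Rightarrow> bool" where
  "schreier B \<longleftrightarrow> connected_subset TYPE('k) B \<and> (\<forall>q\<in>N. Poly_Mapping.keys q \<subseteq> B \<longrightarrow> q = 0)"

lemma schreier_0: "schreier {0}"
proof -
  have "q = 0" if q: "q \<in> N" "Poly_Mapping.keys q \<subseteq> {0}" for q
  proof (rule ccontr)
    assume "q \<noteq> 0"
    define c where "c = Poly_Mapping.lookup q 0"
    have qc: "q = scalar c"
      using q(2) unfolding c_def scalar_def
      by (intro poly_mapping_eqI) (auto simp: lookup_single when_def in_keys_iff)
    with \<open>q \<noteq> 0\<close> have "c \<noteq> 0" by auto
    then have "scalar (inverse c) * q = 1"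
      by (simp add: qc scalar_mult)
    then show False using ideal_mult[OF q(1), of "scalar (inverse c)"] proper by simp
  qed
  then show ?thesis
    using edge_span_0 by (auto simp: schreier_def connected_subset_def)
qed

lemma ex_maximal_schreier: "\<exists>B. schreier B \<and> (\<forall>C. schreier C \<longrightarrow> B \<subseteq> C \<longrightarrow> C = B)"
proof -
  have "\<exists>B\<in>Collect schreier. \<forall>C\<in>Collect schreier. B \<subseteq> C \<longrightarrow> C = B"
  proof (rule subset_Zorn_nonempty)
    show "Collect schreier \<noteq> {}" using schreier_0 by auto
    fix \<C> assume ne: "\<C> \<noteq> {}" and ch: "subset.chain (Collect schreier) \<C>"
    have sch: "schreier B" if "B \<in> \<C>" for B
      using ch that by (auto simp: subset.chain_def)
    have "q = 0" if q: "q \<in> N" "Poly_Mapping.keys q \<subseteq> \<Union>\<C>" for q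
    proof -
      \<comment> \<open>A support is finite, hence contained in a single member of the
        chain.\<close>
      obtain B where "B \<in> \<C>" "Poly_Mapping.keys q \<subseteq> B"
        using finite_subset_Union_chain[OF finite_keys q(2) ne ch] by blast
      then show ?thesis using sch q(1) by (auto simp: schreier_def)
    qed
    then show "\<Union>\<C> \<in> Collect schreier"
      using ne sch by (auto simp: schreier_def intro!: connected_subset_Union)
  qed
  then show ?thesis by auto
qed

text \<open>If \<open>h\<close> is outside \<open>B\<close>, maximality yields a nonzero element of
  \<open>N\<close> supported on \<open>insert h B\<close>. Its coefficient at \<open>h\<close>
  cannot vanish, as \<open>B\<close> is independent, and dividing by it expresses \<open>h\<close>
  in \<open>B\<close> modulo \<open>N\<close>.\<close>

lemma maximal_schreier_step:
  assumes B: "schreier B" and max: "\<forall>C. schreier C \<longrightarrow> B \<subseteq> C \<longrightarrow> C = B"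
    and g: "g \<in> B" and h: "h = fg_gen i + g \<or> g = fg_gen i + h"
  obtains p where "Poly_Mapping.keys p \<subseteq> B" "Poly_Mapping.single h 1 - p \<in> N"
proof (cases "h \<in> B")
  case True
  then show ?thesis using ideal_0 that[of "Poly_Mapping.single h 1"] by simp
next
  case False
  have "connected_subset TYPE('k) (insert h B)"
    using B g h connected_subset_insert by (auto simp: schreier_def)
  moreover have "\<not> schreier (insert h B)"
    using max False by blast
  ultimately obtain q where q: "q \<in> N" "Poly_Mapping.keys q \<subseteq> insert h B" "q \<noteq> 0"
    by (auto simp: schreier_def)
  define c where "c = Poly_Mapping.lookup q h"
  have "c \<noteq> 0"
  proof
    assume "c = 0"
    then have "Poly_Mapping.keys q \<subseteq> B" using q(2) by (auto simp: c_def in_keys_iff)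
    then show False using B q by (auto simp: schreier_def)
  qed
  define m where "m = scalar (inverse c) * q"
  have "m \<in> N" using q(1) by (simp add: m_def ideal_mult)
  moreover have "Poly_Mapping.keys (Poly_Mapping.single h 1 - m) \<subseteq> B"
  proof
    fix x assume x: "x \<in> Poly_Mapping.keys (Poly_Mapping.single h 1 - m)"
    have "x \<noteq> h"
      using x \<open>c \<noteq> 0\<close> by (auto simp: m_def c_def in_keys_iff lookup_minus lookup_scalar_mult)
    then have "x \<in> Poly_Mapping.keys q"
      using x by (auto simp: m_def in_keys_iff lookup_minus lookup_scalar_mult lookup_single)
    then show "x \<in> B" using q(2) \<open>x \<noteq> h\<close> by auto
  qed
  ultimately show ?thesis
    using that[of "Poly_Mapping.single h 1 - m"] by simp
qed

text \<open>The last property provides an element of \<open>N\<close> with augmentation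
  \<open>c\<close>, hence nonzero.\<close>

lemma principal:
  obtains \<delta> where "\<delta> \<in> N" "\<And>a. a \<in> N \<Longrightarrow> \<exists>b. a = b * \<delta>"
    and "\<delta> \<noteq> 0 \<Longrightarrow> \<exists>c p. c \<noteq> 0 \<and> scalar c - (\<Sum>i\<in>UNIV. fox_x i * p i) \<in> N"
proof -
  let ?e = "\<lambda>g. Poly_Mapping.single g (1::'k)"
  obtain B where B: "schreier B" and max: "\<forall>C. schreier C \<longrightarrow> B \<subseteq> C \<longrightarrow> C = B"
    using ex_maximal_schreier by blast
  have conn: "connected_subset TYPE('k) B"
    and indep: "\<And>q. q \<in> N \<Longrightarrow> Poly_Mapping.keys q \<subseteq> B \<Longrightarrow> q = 0"
    using B by (auto simp: schreier_def)
  note step = maximal_schreier_step[OF B max]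

  \<comment> \<open>By \<open>fox_closed\<close>, \<open>u i\<close> and \<open>p i\<close> agree
    modulo \<open>N\<close>, so they are equal by independence; but their supports are
    disjoint.\<close>
  have leaving_indep: "u i = 0"
    if u: "\<And>i. Poly_Mapping.keys (u i) \<subseteq> {g \<in> B. fg_gen i + g \<notin> B}"
      and w: "w \<in> edge_span B" and N: "(\<Sum>i\<in>UNIV. fox_x i * u i) - w \<in> N" for u w i
  proof -
    obtain p where p: "w = (\<Sum>i\<in>UNIV. fox_x i * p i)"
      "\<And>i. Poly_Mapping.keys (p i) \<subseteq> {g \<in> B. fg_gen i + g \<in> B}"
      using w by (rule edge_spanE) blast
    have "(\<Sum>i\<in>UNIV. fox_x i * (u i - p i)) \<in> N"
      using N by (simp add: p(1) right_diff_distrib sum_subtractf)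
    then have "u i - p i \<in> N" by (rule fox_closed)
    moreover have "Poly_Mapping.keys (u i - p i) \<subseteq> B"
      using keys_diff[of "u i" "p i"] u[of i] p(2)[of i] by blast
    ultimately have "u i = p i" using indep by fastforce
    then have "Poly_Mapping.keys (u i) = {}" using u[of i] p(2)[of i] by (simp del: keys_eq_empty) blast
    then show ?thesis by simp
  qed

  \<comment> \<open>Replacing the end of the edge by its expansion \<open>p\<close> makes
    \<open>x\<^sub>i g\<close> congruent to \<open>p - g\<close>, which is a scalar modulo
    \<open>edge_span B\<close>. By \<open>leaving_indep\<close> that scalar is not 0.\<close>
  have leaving: "\<exists>c w. c \<noteq> 0 \<and> w \<in> edge_span B \<and> fox_x i * ?e g - scalar c - w \<in> N"
    if g: "g \<in> B" "fg_gen i + g \<notin> B" for i g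
  proof -
    obtain p where p: "Poly_Mapping.keys p \<subseteq> B" "?e (fg_gen i + g) - p \<in> N"
      using step[OF g(1)] by blast
    have "Poly_Mapping.keys (p - ?e g) \<subseteq> B"
      using keys_diff[of p "?e g"] p(1) g(1) by auto
    then obtain c where c: "p - ?e g - scalar c \<in> edge_span B"
      using connected_subset_diff_scalar[OF conn] by blast
    have N: "fox_x i * ?e g - scalar c - (p - ?e g - scalar c) \<in> N"
      using p(2) by (simp add: fox_x_mult_single algebra_simps)
    moreover have "c \<noteq> 0"
    proof
      assume "c = 0"
      let ?u = "\<lambda>j. if j = i then ?e g else 0"
      have "?u i = 0"
        using g c N \<open>c = 0\<close>
        by (intro leaving_indep[of ?u "p - ?e g - scalar c"]) (auto simp: sum_fox_x_single)
      then have "Poly_Mapping.lookup (?e g) g = 0" by simp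
      then show False by simp
    qed
    ultimately show ?thesis using c by blast
  qed

  have unique: "i = j \<and> g = h"
    if g: "g \<in> B" "fg_gen i + g \<notin> B" and h: "h \<in> B" "fg_gen j + h \<notin> B" for i j g h
  proof (rule ccontr)
    assume ne: "\<not> (i = j \<and> g = h)"
    obtain c v where c: "c \<noteq> 0" "v \<in> edge_span B" "fox_x i * ?e g - scalar c - v \<in> N"
      using leaving[OF g] by blast
    obtain d w where d: "d \<noteq> 0" "w \<in> edge_span B" "fox_x j * ?e h - scalar d - w \<in> N"
      using leaving[OF h] by blast
    \<comment> \<open>The weights \<open>d\<close> and \<open>-c\<close> eliminate the constant
      terms of the two congruences, so that \<open>leaving_indep\<close> applies.\<close>
    define u where "u = (\<lambda>k. (if k = i then scalar d * ?e g else 0) - (if k = j then scalar c * ?e h else 0))"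
    have "(\<Sum>k\<in>UNIV. fox_x k * u k) - (scalar d * v - scalar c * w)
        = scalar d * (fox_x i * ?e g - scalar c - v) - scalar c * (fox_x j * ?e h - scalar d - w)"
      by (simp add: u_def right_diff_distrib sum_subtractf sum_fox_x_single scalar_left_commute
          scalar_mult mult.commute[of d c])
    then have N: "(\<Sum>k\<in>UNIV. fox_x k * u k) - (scalar d * v - scalar c * w) \<in> N"
      using c(3) d(3) by (simp add: ideal_diff ideal_mult)
    have "u i = 0"
    proof (rule leaving_indep[OF _ _ N])
      show "Poly_Mapping.keys (u k) \<subseteq> {g \<in> B. fg_gen k + g \<notin> B}" for k
        using g h keys_diff[of "if k = i then scalar d * ?e g else 0" "if k = j then scalar c * ?e h else 0"]
        by (auto simp: u_def scalar_mult_single split: if_splits)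
      show "scalar d * v - scalar c * w \<in> edge_span B"
        using c(2) d(2) by (intro edge_span_diff edge_span_scalar)
    qed
    moreover have "Poly_Mapping.lookup (u i) g = d"
      using ne by (auto simp: u_def lookup_minus scalar_mult_single lookup_single when_def)
    ultimately show False using d(1) by simp
  qed

  obtain \<delta> where \<delta>: "\<delta> \<in> N"
    and red: "\<And>i g. g \<in> B \<Longrightarrow>
      \<exists>p a. Poly_Mapping.keys p \<subseteq> B \<and> ?e (fg_gen i + g) = p + a * \<delta>"
    and edge: "\<delta> \<noteq> 0 \<Longrightarrow> \<exists>i g. g \<in> B \<and> fg_gen i + g \<notin> B"
  proof (cases "\<exists>i g. g \<in> B \<and> fg_gen i + g \<notin> B")
    case True
    then obtain i g where g: "g \<in> B" "fg_gen i + g \<notin> B" by blast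
    obtain p where p: "Poly_Mapping.keys p \<subseteq> B" "?e (fg_gen i + g) - p \<in> N"
      using step[OF g(1)] by blast
    \<comment> \<open>Inner edges need no reduction; by \<open>unique\<close> the only other edge is
      the chosen one, reduced by one copy of the generator.\<close>
    have "\<exists>q a. Poly_Mapping.keys q \<subseteq> B \<and> ?e (fg_gen j + h) = q + a * (?e (fg_gen i + g) - p)"
      if h: "h \<in> B" for j h
    proof (cases "fg_gen j + h \<in> B")
      case True
      then show ?thesis by (intro exI[of _ "?e (fg_gen j + h)"] exI[of _ 0]) simp
    next
      case False
      then have "i = j" "g = h" using unique[OF g h] by auto
      then show ?thesis using p(1) by (intro exI[of _ p] exI[of _ 1]) simp
    qed
    with p(2) True show ?thesis by (intro that) auto
  next
    case False
    \<comment> \<open>With no leaving edge, \<open>B\<close> is closed under adding generators on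
      the left, and \<open>\<delta> = 0\<close> serves.\<close>
    show ?thesis
    proof (rule that[OF ideal_0])
      show "\<exists>p a. Poly_Mapping.keys p \<subseteq> B \<and> ?e (fg_gen i + g) = p + a * 0" if "g \<in> B" for i g
        using False that by (intro exI[of _ "?e (fg_gen i + g)"]) auto
    qed simp
  qed

  \<comment> \<open>The aim is \<open>U = \<Lambda>\<close>: it contains 1 and is closed under left
    multiplication by all letters.\<close>
  define U where "U = {p + a * \<delta> | p a. Poly_Mapping.keys p \<subseteq> B}"
  have U_I: "p + a * \<delta> \<in> U" if "Poly_Mapping.keys p \<subseteq> B" for p a
    using that by (auto simp: U_def)
  have U_add: "a + b \<in> U" if ab: "a \<in> U" "b \<in> U" for a b
  proof -
    obtain p a' q b' where *: "Poly_Mapping.keys p \<subseteq> B" "Poly_Mapping.keys q \<subseteq> B"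
      "a = p + a' * \<delta>" "b = q + b' * \<delta>"
      using ab by (auto simp: U_def)
    have "(p + q) + (a' + b') * \<delta> \<in> U"
      using keys_add[of p q] * by (intro U_I) auto
    then show ?thesis by (simp add: * algebra_simps)
  qed
  have U_scalar: "scalar c * a \<in> U" if a: "a \<in> U" for c a
  proof -
    obtain p a' where *: "Poly_Mapping.keys p \<subseteq> B" "a = p + a' * \<delta>"
      using a by (auto simp: U_def)
    have "scalar c * p + (scalar c * a') * \<delta> \<in> U"
      using keys_scalar_mult[of c p] * by (intro U_I) auto
    then show ?thesis by (simp add: * distrib_left mult.assoc)
  qed
  \<comment> \<open>The summand \<open>\<Lambda>\<delta>\<close> is stable under left
    multiplication, so only elements of \<open>B\<close> have to be tested.\<close>
  have U_mult: "a * q \<in> U" if a: "\<And>g. g \<in> B \<Longrightarrow> a * ?e g \<in> U" and q: "q \<in> U" for a q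
  proof -
    obtain p b where *: "Poly_Mapping.keys p \<subseteq> B" "q = p + b * \<delta>"
      using q by (auto simp: U_def)
    have "a * p \<in> U"
    proof (induction p rule: poly_mapping_span_induct)
      case zero
      show ?case using U_I[of 0 0] by simp
    next
      case (add p q)
      then show ?case using U_add by (simp add: distrib_left)
    next
      case (single g c)
      then have "scalar c * (a * ?e g) \<in> U" using a * U_scalar by blast
      then show ?case by (simp add: scalar_left_commute[symmetric] scalar_mult_single)
    qed
    moreover have "(a * b) * \<delta> \<in> U" using U_I[of 0 "a * b"] by simp
    ultimately show ?thesis using U_add by (simp add: * distrib_left mult.assoc)
  qed
  have U_gen: "?e (fg_gen i) * q \<in> U" if "q \<in> U" for i q
  proof (rule U_mult[OF _ that])
    fix g assume "g \<in> B"
    then obtain p a where "Poly_Mapping.keys p \<subseteq> B" "?e (fg_gen i + g) = p + a * \<delta>"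
      using red by blast
    then show "?e (fg_gen i) * ?e g \<in> U" using U_I by (simp add: mult_single)
  qed
  \<comment> \<open>If \<open>p\<close> in the span of \<open>B\<close> is congruent to \<open>t\<^sub>i\<^sup>-\<^sup>1 g\<close> modulo \<open>N\<close>, then \<open>t\<^sub>i p\<close> reduces modulo \<open>\<Lambda>\<delta>\<close>
    to an element of the span of \<open>B\<close> that is congruent to \<open>g\<close> modulo \<open>N\<close>, hence equal to \<open>g\<close>.\<close>
  have U_gen_inv: "?e (- fg_gen i) * q \<in> U" if "q \<in> U" for i q
  proof (rule U_mult[OF _ that])
    fix g assume g: "g \<in> B"
    obtain p where p: "Poly_Mapping.keys p \<subseteq> B" "?e (- fg_gen i + g) - p \<in> N"
      using step[OF g, of "- fg_gen i + g" i] by (auto simp: add.assoc[symmetric])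
    have "p \<in> U" using U_I[OF p(1), of 0] by simp
    then obtain q a where q: "Poly_Mapping.keys q \<subseteq> B" "?e (fg_gen i) * p = q + a * \<delta>"
      using U_gen[of p i] by (auto simp: U_def)
    have "?e (fg_gen i) * (?e (- fg_gen i + g) - p) + a * \<delta> \<in> N"
      using p(2) \<delta> by (intro ideal_plus ideal_mult)
    moreover have "?e (fg_gen i) * (?e (- fg_gen i + g) - p) + a * \<delta> = ?e g - q"
      by (simp add: right_diff_distrib q(2) mult_single add.assoc[symmetric])
    moreover have "Poly_Mapping.keys (?e g - q) \<subseteq> B"
      using keys_diff[of "?e g" q] g q(1) by auto
    ultimately have "?e g - q = 0" using indep by metis
    then have "?e g = ?e (fg_gen i) * p - a * \<delta>"
      by (simp add: q(2))
    then have "?e (- fg_gen i) * ?e g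
        = ?e (- fg_gen i) * ?e (fg_gen i) * p + (- (?e (- fg_gen i) * a)) * \<delta>"
      by (simp add: right_diff_distrib mult.assoc)
    also have "\<dots> = p + (- (?e (- fg_gen i) * a)) * \<delta>"
      by (simp add: mult_single)
    finally show "?e (- fg_gen i) * ?e g \<in> U"
      using U_I[OF p(1)] by metis
  qed
  have "?e g \<in> U" for g
  proof (induction g rule: free_group_induct)
    case zero
    show ?case using conn U_I[of 1 0] by (simp add: connected_subset_def)
  next
    case (gen i g)
    then show ?case using U_gen[of "?e g" i] by (simp add: mult_single)
  next
    case (gen_inv i g)
    then show ?case using U_gen_inv[of "?e g" i] by (simp add: mult_single)
  qed
  then have U_single: "Poly_Mapping.single g c \<in> U" for g c
    using U_scalar[of "?e g" c] by (simp add: scalar_mult_single)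
  have U_UNIV: "q \<in> U" for q
    using U_I[of 0 0] U_add U_single by (induction q rule: poly_mapping_span_induct) auto
  show ?thesis
  proof (rule that[OF \<delta>])
    fix a assume a: "a \<in> N"
    obtain p b where p: "Poly_Mapping.keys p \<subseteq> B" "a = p + b * \<delta>"
      using U_UNIV[of a] by (auto simp: U_def)
    have "a - b * \<delta> \<in> N" using a \<delta> by (intro ideal_diff ideal_mult)
    then have "p = 0" using p indep by simp
    then show "\<exists>b. a = b * \<delta>" using p(2) by auto
  next
    assume "\<delta> \<noteq> 0"
    then obtain i g where g: "g \<in> B" "fg_gen i + g \<notin> B" using edge by blast
    obtain c w where c: "c \<noteq> 0" "w \<in> edge_span B" "fox_x i * ?e g - scalar c - w \<in> N"
      using leaving[OF g] by blast
    obtain p where p: "w = (\<Sum>i\<in>UNIV. fox_x i * p i)"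
      using c(2) by (rule edge_spanE) blast
    \<comment> \<open>Gathers the leaving edge and the boundary \<open>w\<close> into one family of
      coefficients of the \<open>x\<^sub>j\<close>.\<close>
    define r where "r = (\<lambda>j. (if j = i then ?e g else 0) - p j)"
    have "scalar c - (\<Sum>j\<in>UNIV. fox_x j * r j) \<in> N"
      using ideal_neg[OF c(3)]
      by (simp add: right_diff_distrib sum_subtractf sum_fox_x_single p r_def algebra_simps)
    then show "\<exists>c p. c \<noteq> 0 \<and> scalar c - (\<Sum>i\<in>UNIV. fox_x i * p i) \<in> N"
      using c(1) by (intro exI[of _ c] exI[of _ r]) simp
  qed
qed

end


subsection \<open>The Fox algebra\<close>

definition fox_star :: "'n \<Rightarrow> ('n::finite, 'k::field) fox_algebra" where
  "fox_star i = abs_fox_algebra (free_gen (Star i))"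

lemma abs_fox_algebra_eqI: "a - b \<in> fox_relations \<Longrightarrow> abs_fox_algebra a = abs_fox_algebra b"
  by (simp add: fox_algebra.abs_eq_iff fox_eq_def ideal_gen)

lemma fox_of_add: "fox_of (a + b) = fox_of a + fox_of b"
  using abs_fox_algebra_eqI[OF fox_relations.intros(1)[of a b]]
  by (simp add: fox_of_def plus_fox_algebra.abs_eq)

lemma fox_of_mult: "fox_of (a * b) = fox_of a * fox_of b"
  using abs_fox_algebra_eqI[OF fox_relations.intros(2)[of a b]]
  by (simp add: fox_of_def times_fox_algebra.abs_eq)

lemma fox_of_1: "fox_of 1 = 1"
  using abs_fox_algebra_eqI[OF fox_relations.intros(3)[of 1]]
  by (simp add: fox_of_def one_fox_algebra_def)

lemma fox_of_0: "fox_of 0 = 0"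
  using fox_of_add[of 0 0] by simp

lemma fox_of_sum: "fox_of (\<Sum>i\<in>A. f i) = (\<Sum>i\<in>A. fox_of (f i))"
  by (induction A rule: infinite_finite_induct) (simp_all add: fox_of_0 fox_of_add)

lemma fox_star_mult: "fox_star i * fox_of (fox_x j) = (if i = j then 1 else 0)"
  using abs_fox_algebra_eqI[OF fox_relations.intros(4)[of i j]]
  by (simp add: fox_of_def fox_star_def times_fox_algebra.abs_eq one_fox_algebra_def
      zero_fox_algebra_def split: if_splits)

text \<open>By orthogonality of the stars to the \<open>x\<^sub>j\<close>, \<open>fox_star i\<close>
  acts on the augmentation ideal as the \<open>i\<close>-th Fox derivative.\<close>

lemma fox_star_sum: "fox_star i * fox_of (\<Sum>j\<in>UNIV. fox_x j * p j) = fox_of (p i)"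
proof -
  have "fox_star i * fox_of (\<Sum>j\<in>UNIV. fox_x j * p j)
      = (\<Sum>j\<in>UNIV. fox_star i * fox_of (fox_x j) * fox_of (p j))"
    by (simp add: fox_of_sum fox_of_mult sum_distrib_left mult.assoc)
  also have "\<dots> = (\<Sum>j\<in>UNIV. if i = j then fox_of (p j) else 0)"
    by (intro sum.cong) (auto simp: fox_star_mult)
  finally show ?thesis by simp
qed

theorem corollary7p25:
  fixes \<gamma> :: "('n::finite, 'k::field) free_group_algebra"
  assumes "CARD('n) \<ge> 2"
    and "augmentation \<gamma> = 0"
    and "ring_irreducible \<gamma>"
  shows "principal_left_ideal (fox_of \<gamma>) = (UNIV :: ('n, 'k) fox_algebra set)"
proof -
  let ?L = "principal_left_ideal (fox_of \<gamma>)"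
  define N where "N = {a. fox_of a \<in> ?L}"
  have L_mult: "b * a \<in> ?L" if "a \<in> ?L" for a b
    using that by (auto simp: principal_left_ideal_def mult.assoc[symmetric])
  have L_add: "a + b \<in> ?L" if "a \<in> ?L" "b \<in> ?L" for a b
    using that by (auto simp: principal_left_ideal_def distrib_right[symmetric])
  have L_self: "fox_of \<gamma> \<in> ?L"
    unfolding principal_left_ideal_def by (metis (mono_tags) mem_Collect_eq mult_1)
  then have \<gamma>: "\<gamma> \<in> N" by (simp add: N_def)
  have "1 \<in> N"
  proof (rule ccontr)
    assume "1 \<notin> N"
    interpret fox_closed_ideal N
    proof
      show "0 \<in> N" using L_mult[OF L_self, of 0] by (simp add: N_def fox_of_0)
      show "a + b \<in> N" if "a \<in> N" "b \<in> N" for a b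
        using that L_add by (simp add: N_def fox_of_add)
      show "a * b \<in> N" if "b \<in> N" for a b
        using that L_mult by (simp add: N_def fox_of_mult)
      show "p i \<in> N" if "(\<Sum>i\<in>UNIV. fox_x i * p i) \<in> N" for p i
        using that L_mult[of _ "fox_star i"] by (simp add: N_def flip: fox_star_sum)
    qed fact
    obtain \<delta> where \<delta>: "\<delta> \<in> N" and gen: "\<And>a. a \<in> N \<Longrightarrow> \<exists>b. a = b * \<delta>"
      and edge: "\<delta> \<noteq> 0 \<Longrightarrow> \<exists>c p. c \<noteq> 0 \<and> scalar c - (\<Sum>i\<in>UNIV. fox_x i * p i) \<in> N"
      using principal by blast
    obtain a where a: "\<gamma> = a * \<delta>" using gen \<gamma> by blast
    have "\<not> ring_unit (0 :: ('n, 'k) free_group_algebra)"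
      by (simp add: ring_unit_def)
    \<comment> \<open>Irreducibility excludes 0, since \<open>0 = 0 * 0\<close> with 0 a
      non-unit.\<close>
    then have "\<gamma> \<noteq> 0" using assms(3) by (metis mult_zero_left ring_irreducible_def)
    then have "\<delta> \<noteq> 0" using a by auto
    then obtain c p where c: "c \<noteq> 0" "scalar c - (\<Sum>i\<in>UNIV. fox_x i * p i) \<in> N"
      using edge by blast
    obtain b where b: "scalar c - (\<Sum>i\<in>UNIV. fox_x i * p i) = b * \<delta>"
      using gen c(2) by blast
    have "ring_unit a \<or> ring_unit \<delta>"
      using assms(3) a by (auto simp: ring_irreducible_def)
    then show False
    proof
      \<comment> \<open>Here \<open>\<delta>\<close> is a multiple of \<open>\<gamma>\<close>, so
        all of \<open>N\<close> has augmentation 0, whereas the element found above has augmentation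
        \<open>c\<close>.\<close>
      assume "ring_unit a"
      then obtain v where "v * a = 1" by (auto simp: ring_unit_def)
      then have "\<delta> = v * \<gamma>" by (simp add: a mult.assoc[symmetric])
      then have "augmentation \<delta> = 0" by (simp add: augmentation_mult assms(2))
      then have "augmentation (scalar c - (\<Sum>i\<in>UNIV. fox_x i * p i)) = 0"
        by (simp add: b augmentation_mult)
      then show False
        using c(1) by (simp add: augmentation_diff augmentation_sum augmentation_mult)
    next
      assume "ring_unit \<delta>"
      then obtain v where "v * \<delta> = 1" by (auto simp: ring_unit_def)
      then show False using ideal_mult[OF \<delta>, of v] proper by simp
    qed
  qed
  then have "1 \<in> ?L" by (simp add: N_def fox_of_1)
  then show ?thesis using L_mult by (metis UNIV_eq_I mult.right_neutral)
qed

end
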